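(* For each $L\in\{N, NeF, CoPC, MPC\}$, for every finite multiset of formulas $\Gamma$ and every formula $\varphi$: the sequent $\Gamma\Rightarrow\varphi$ is derivable in $\mathbf{G3}L$ if and only if the history sequent $\emptyset\mid\Gamma\Rightarrow\varphi$ is derivable in $\mathbf{G3}L^{Hist}$.
   Context: Formulas are generated from a countable set of propositional variables $p,q,\dots$ and the constant $\top$ by the grammar $\varphi::= p\mid\top\mid\varphi\wedge\varphi\mid\varphi\vee\varphi\mid\varphi\to\varphi\mid\neg\varphi$ (there is no constant $\bot$). Ordinary systems. A sequent is $\Gamma\Rightarrow\varphi$ with $\Gamma$ a finite multiset of formulas and $\varphi$ a formula; $\Gamma,\alpha$ denotes $\Gamma$ with one more occurrence of $\alpha$. Rules: (ax) $\Gamma,p\Rightarrow p$; ($\top$) $\Gamma\Rightarrow\top$; ($\to$r) from $\Gamma,\alpha\Rightarrow\beta$ infer $\Gamma\Rightarrow\alpha\to\beta$; ($\to$l) from $\Gamma,\alpha\to\beta\Rightarrow\alpha$ and $\Gamma,\beta\Rightarrow\varphi$ infer $\Gamma,\alpha\to\beta\Rightarrow\varphi$; ($\wedge$r) from $\Gamma\Rightarrow\alpha$ and $\Gamma\Rightarrow\beta$ infer $\Gamma\Rightarrow\alpha\wedge\beta$; ($\wedge$l) from $\Gamma,\alpha,\beta\Rightarrow\varphi$ infer $\Gamma,\alpha\wedge\beta\Rightarrow\varphi$; ($\vee$r$_1$), ($\vee$r$_2$) from $\Gamma\Rightarrow\alpha$ (resp. $\Gamma\Rightarrow\beta$) infer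 $\Gamma\Rightarrow\alpha\vee\beta$; ($\vee$l) from $\Gamma,\alpha\Rightarrow\varphi$ and $\Gamma,\beta\Rightarrow\varphi$ infer $\Gamma,\alpha\vee\beta\Rightarrow\varphi$; (n) from $\Gamma,\neg\alpha,\beta\Rightarrow\alpha$ and $\Gamma,\neg\alpha,\alpha\Rightarrow\beta$ infer $\Gamma,\neg\alpha\Rightarrow\neg\beta$; (nef) from $\Gamma,\neg\alpha\Rightarrow\alpha$ infer $\Gamma,\neg\alpha\Rightarrow\neg\beta$; (copc) from $\Gamma,\neg\alpha,\beta\Rightarrow\alpha$ infer $\Gamma,\neg\alpha\Rightarrow\neg\beta$; (an) from $\Gamma,\alpha\Rightarrow\neg\alpha$ infer $\Gamma\Rightarrow\neg\alpha$. Positive rules: (ax) through ($\vee$l). $\mathbf{G3N}$ = positive + (n); $\mathbf{G3NeF}$ = positive + (n) + (nef); $\mathbf{G3CoPC}$ = positive + (copc); $\mathbf{G3MPC}$ = positive + (copc) + (an); no weakening, contraction or cut rules. History systems. A history sequent is $\mathcal H\mid\Gamma\Rightarrow\varphi$ where $\mathcal H$ (the history) is a finite set of formulas, $\Gamma$ a finite multiset, $\varphi$ a formula (the goal). $(\psi,\mathcal H)$ denotes $\mathcal H\cup\{\psi\}$, $\emptyset$ is the empty history, "$\alpha\in\Gamma$" means $\alpha$ occurs in $\Gamma$. History rules (side conditions after "if"): (ax) $\mathcal H\mid\Gamma,p\Rightarrow p$; ($\top$) $\mathcal H\mid\Gamma\Rightarrow\top$; ($\to$r$_1$) from $\emptyset\mid\Gamma,\alpha\Rightarrow\beta$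 infer $\mathcal H\mid\Gamma\Rightarrow\alpha\to\beta$, if $\alpha\notin\Gamma$; ($\to$r$_2$) from $\mathcal H\mid\Gamma\Rightarrow\beta$ infer $\mathcal H\mid\Gamma\Rightarrow\alpha\to\beta$, if $\alpha\in\Gamma$; ($\to$l) from $(\varphi,\mathcal H)\mid\Gamma,\alpha\to\beta\Rightarrow\alpha$ and $\emptyset\mid\Gamma,\alpha\to\beta,\beta\Rightarrow\varphi$ infer $\mathcal H\mid\Gamma,\alpha\to\beta\Rightarrow\varphi$, if $\varphi\notin\mathcal H$ and $\beta\notin\Gamma$; ($\wedge$r) from $\mathcal H\mid\Gamma\Rightarrow\alpha$ and $\mathcal H\mid\Gamma\Rightarrow\beta$ infer $\mathcal H\mid\Gamma\Rightarrow\alpha\wedge\beta$; ($\wedge$l$_1$) from $\emptyset\mid\Gamma,\alpha\wedge\beta,\alpha\Rightarrow\varphi$ infer $\mathcal H\mid\Gamma,\alpha\wedge\beta\Rightarrow\varphi$, if $\alpha\notin\Gamma$; ($\wedge$l$_2$) from $\emptyset\mid\Gamma,\alpha\wedge\beta,\beta\Rightarrow\varphi$ infer $\mathcal H\mid\Gamma,\alpha\wedge\beta\Rightarrow\varphi$, if $\beta\notin\Gamma$; ($\vee$r$_1$), ($\vee$r$_2$) from $\mathcal H\mid\Gamma\Rightarrow\alpha$ (resp. $\mathcal H\mid\Gamma\Rightarrow\beta$) infer $\mathcal H\mid\Gamma\Rightarrow\alpha\vee\beta$; ($\vee$l) from $\emptyset\mid\Gamma,\alpha\vee\beta,\alpha\Rightarrow\varphi$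 and $\emptyset\mid\Gamma,\alpha\vee\beta,\beta\Rightarrow\varphi$ infer $\mathcal H\mid\Gamma,\alpha\vee\beta\Rightarrow\varphi$, if $\alpha,\beta\notin\Gamma$; (n$_1$) from $\emptyset\mid\Gamma,\neg\alpha,\beta\Rightarrow\alpha$ and $\emptyset\mid\Gamma,\neg\alpha,\alpha\Rightarrow\beta$ infer $\mathcal H\mid\Gamma,\neg\alpha\Rightarrow\neg\beta$, if $\beta\notin\Gamma\cup\{\neg\alpha\}$ and $\alpha\notin\Gamma$; (n$_2$) from $\emptyset\mid\Gamma,\neg\alpha,\beta\Rightarrow\alpha$ and $\mathcal H\mid\Gamma,\neg\alpha\Rightarrow\beta$ infer $\mathcal H\mid\Gamma,\neg\alpha\Rightarrow\neg\beta$, if $\beta\notin\Gamma\cup\{\neg\alpha\}$ and $\alpha\in\Gamma$; (n$_3$) from $(\neg\beta,\mathcal H)\mid\Gamma,\neg\alpha\Rightarrow\alpha$ and $\emptyset\mid\Gamma,\neg\alpha,\alpha\Rightarrow\beta$ infer $\mathcal H\mid\Gamma,\neg\alpha\Rightarrow\neg\beta$, if $\neg\beta\notin\mathcal H$, $\beta\in\Gamma\cup\{\neg\alpha\}$ and $\alpha\notin\Gamma$; (n$_4$) from $(\neg\beta,\mathcal H)\mid\Gamma,\neg\alpha\Rightarrow\alpha$ and $\mathcal H\mid\Gamma,\neg\alpha\Rightarrow\beta$ infer $\mathcal H\mid\Gamma,\neg\alpha\Rightarrow\neg\beta$, if $\neg\beta\notin\mathcal H$, $\beta\in\Gamma\cup\{\neg\alpha\}$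 and $\alpha\in\Gamma$; (nef) from $(\neg\beta,\mathcal H)\mid\Gamma,\neg\alpha\Rightarrow\alpha$ infer $\mathcal H\mid\Gamma,\neg\alpha\Rightarrow\neg\beta$, if $\neg\beta\notin\mathcal H$; (copc$_1$) from $\emptyset\mid\Gamma,\neg\alpha,\beta\Rightarrow\alpha$ infer $\mathcal H\mid\Gamma,\neg\alpha\Rightarrow\neg\beta$, if $\beta\notin\Gamma\cup\{\neg\alpha\}$; (copc$_2$) from $(\neg\beta,\mathcal H)\mid\Gamma,\neg\alpha\Rightarrow\alpha$ infer $\mathcal H\mid\Gamma,\neg\alpha\Rightarrow\neg\beta$, if $\neg\beta\notin\mathcal H$ and $\beta\in\Gamma\cup\{\neg\alpha\}$; (an) from $\emptyset\mid\Gamma,\alpha\Rightarrow\neg\alpha$ infer $\mathcal H\mid\Gamma\Rightarrow\neg\alpha$, if $\alpha\notin\Gamma$. In addition, ($\to$l), ($\wedge$l$_1$), ($\wedge$l$_2$), ($\vee$l) may only be applied when the goal $\varphi$ of the conclusion is a propositional variable, a negation or a disjunction. $\mathbf{G3N}^{Hist}$ = positive history rules (ax)–($\vee$l) + (n$_1$)–(n$_4$); $\mathbf{G3NeF}^{Hist}$ = positive history rules + (n$_1$)–(n$_4$) + (nef); $\mathbf{G3CoPC}^{Hist}$ = positive history rules + (copc$_1$), (copc$_2$); $\mathbf{G3MPC}^{Hist}$ = positive history rules + (copc$_1$), (copc$_2$), (an). In both kinds of systems, a derivation is a finite tree of rule instances whose leaves are instances of (ax) or ($\top$). *)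

theory Defs
  imports Main "HOL-Library.Multiset" "HOL-Library.FSet"
begin

datatype form = Var nat | Top | And form form | Or form form | Imp form form | Neg form

datatype logic = N | NeF | CoPC | MPC

definition has_n :: "logic \<Rightarrow> bool" where "has_n L \<longleftrightarrow> L = N \<or> L = NeF"
definition has_nef :: "logic \<Rightarrow> bool" where "has_nef L \<longleftrightarrow> L = NeF"
definition has_copc :: "logic \<Rightarrow> bool" where "has_copc L \<longleftrightarrow> L = CoPC \<or> L = MPC"
definition has_an :: "logic \<Rightarrow> bool" where "has_an L \<longleftrightarrow> L = MPC"

inductive G3 :: "logic \<Rightarrow> form multiset \<Rightarrow> form \<Rightarrow> bool" for L where
  ax: "G3 L (\<Gamma> + {#Var p#}) (Var p)"
| top: "G3 L \<Gamma> Top"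
| impR: "G3 L (\<Gamma> + {#\<alpha>#}) \<beta> \<Longrightarrow> G3 L \<Gamma> (Imp \<alpha> \<beta>)"
| impL: "G3 L (\<Gamma> + {#Imp \<alpha> \<beta>#}) \<alpha> \<Longrightarrow> G3 L (\<Gamma> + {#\<beta>#}) \<phi>
         \<Longrightarrow> G3 L (\<Gamma> + {#Imp \<alpha> \<beta>#}) \<phi>"
| andR: "G3 L \<Gamma> \<alpha> \<Longrightarrow> G3 L \<Gamma> \<beta> \<Longrightarrow> G3 L \<Gamma> (And \<alpha> \<beta>)"
| andL: "G3 L (\<Gamma> + {#\<alpha>#} + {#\<beta>#}) \<phi> \<Longrightarrow> G3 L (\<Gamma> + {#And \<alpha> \<beta>#}) \<phi>"
| orR1: "G3 L \<Gamma> \<alpha> \<Longrightarrow> G3 L \<Gamma> (Or \<alpha> \<beta>)"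
| orR2: "G3 L \<Gamma> \<beta> \<Longrightarrow> G3 L \<Gamma> (Or \<alpha> \<beta>)"
| orL: "G3 L (\<Gamma> + {#\<alpha>#}) \<phi> \<Longrightarrow> G3 L (\<Gamma> + {#\<beta>#}) \<phi>
        \<Longrightarrow> G3 L (\<Gamma> + {#Or \<alpha> \<beta>#}) \<phi>"
| n: "has_n L \<Longrightarrow> G3 L (\<Gamma> + {#Neg \<alpha>#} + {#\<beta>#}) \<alpha>
      \<Longrightarrow> G3 L (\<Gamma> + {#Neg \<alpha>#} + {#\<alpha>#}) \<beta>
      \<Longrightarrow> G3 L (\<Gamma> + {#Neg \<alpha>#}) (Neg \<beta>)"
| nef: "has_nef L \<Longrightarrow> G3 L (\<Gamma> + {#Neg \<alpha>#}) \<alpha>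
      \<Longrightarrow> G3 L (\<Gamma> + {#Neg \<alpha>#}) (Neg \<beta>)"
| copc: "has_copc L \<Longrightarrow> G3 L (\<Gamma> + {#Neg \<alpha>#} + {#\<beta>#}) \<alpha>
      \<Longrightarrow> G3 L (\<Gamma> + {#Neg \<alpha>#}) (Neg \<beta>)"
| an: "has_an L \<Longrightarrow> G3 L (\<Gamma> + {#\<alpha>#}) (Neg \<alpha>) \<Longrightarrow> G3 L \<Gamma> (Neg \<alpha>)"

fun left_goal :: "form \<Rightarrow> bool" where
  "left_goal (Var p) = True"
| "left_goal (Neg _) = True"
| "left_goal (Or _ _) = True"
| "left_goal _ = False"

inductive G3H :: "logic \<Rightarrow> form fset \<Rightarrow> form multiset \<Rightarrow> form \<Rightarrow> bool" for L where
  ax: "G3H L H (\<Gamma> + {#Var p#}) (Var p)"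
| top: "G3H L H \<Gamma> Top"
| impR1: "\<alpha> \<notin># \<Gamma> \<Longrightarrow> G3H L {||} (\<Gamma> + {#\<alpha>#}) \<beta> \<Longrightarrow> G3H L H \<Gamma> (Imp \<alpha> \<beta>)"
| impR2: "\<alpha> \<in># \<Gamma> \<Longrightarrow> G3H L H \<Gamma> \<beta> \<Longrightarrow> G3H L H \<Gamma> (Imp \<alpha> \<beta>)"
| impL: "left_goal \<phi> \<Longrightarrow> \<phi> |\<notin>| H \<Longrightarrow> \<beta> \<notin># \<Gamma>
         \<Longrightarrow> G3H L (finsert \<phi> H) (\<Gamma> + {#Imp \<alpha> \<beta>#}) \<alpha>
         \<Longrightarrow> G3H L {||} (\<Gamma> + {#Imp \<alpha> \<beta>#} + {#\<beta>#}) \<phi>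
         \<Longrightarrow> G3H L H (\<Gamma> + {#Imp \<alpha> \<beta>#}) \<phi>"
| andR: "G3H L H \<Gamma> \<alpha> \<Longrightarrow> G3H L H \<Gamma> \<beta> \<Longrightarrow> G3H L H \<Gamma> (And \<alpha> \<beta>)"
| andL1: "left_goal \<phi> \<Longrightarrow> \<alpha> \<notin># \<Gamma>
         \<Longrightarrow> G3H L {||} (\<Gamma> + {#And \<alpha> \<beta>#} + {#\<alpha>#}) \<phi>
         \<Longrightarrow> G3H L H (\<Gamma> + {#And \<alpha> \<beta>#}) \<phi>"
| andL2: "left_goal \<phi> \<Longrightarrow> \<beta> \<notin># \<Gamma>
         \<Longrightarrow> G3H L {||} (\<Gamma> + {#And \<alpha> \<beta>#} + {#\<beta>#}) \<phi>
         \<Longrightarrow> G3H L H (\<Gamma> + {#And \<alpha> \<beta>#}) \<phi>"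
| orR1: "G3H L H \<Gamma> \<alpha> \<Longrightarrow> G3H L H \<Gamma> (Or \<alpha> \<beta>)"
| orR2: "G3H L H \<Gamma> \<beta> \<Longrightarrow> G3H L H \<Gamma> (Or \<alpha> \<beta>)"
| orL: "left_goal \<phi> \<Longrightarrow> \<alpha> \<notin># \<Gamma> \<Longrightarrow> \<beta> \<notin># \<Gamma>
        \<Longrightarrow> G3H L {||} (\<Gamma> + {#Or \<alpha> \<beta>#} + {#\<alpha>#}) \<phi>
        \<Longrightarrow> G3H L {||} (\<Gamma> + {#Or \<alpha> \<beta>#} + {#\<beta>#}) \<phi>
        \<Longrightarrow> G3H L H (\<Gamma> + {#Or \<alpha> \<beta>#}) \<phi>"
| n1: "has_n L \<Longrightarrow> \<beta> \<notin># \<Gamma> \<Longrightarrow> \<beta> \<noteq> Neg \<alpha> \<Longrightarrow> \<alpha> \<notin># \<Gamma>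
       \<Longrightarrow> G3H L {||} (\<Gamma> + {#Neg \<alpha>#} + {#\<beta>#}) \<alpha>
       \<Longrightarrow> G3H L {||} (\<Gamma> + {#Neg \<alpha>#} + {#\<alpha>#}) \<beta>
       \<Longrightarrow> G3H L H (\<Gamma> + {#Neg \<alpha>#}) (Neg \<beta>)"
| n2: "has_n L \<Longrightarrow> \<beta> \<notin># \<Gamma> \<Longrightarrow> \<beta> \<noteq> Neg \<alpha> \<Longrightarrow> \<alpha> \<in># \<Gamma>
       \<Longrightarrow> G3H L {||} (\<Gamma> + {#Neg \<alpha>#} + {#\<beta>#}) \<alpha>
       \<Longrightarrow> G3H L H (\<Gamma> + {#Neg \<alpha>#}) \<beta>
       \<Longrightarrow> G3H L H (\<Gamma> + {#Neg \<alpha>#}) (Neg \<beta>)"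
| n3: "has_n L \<Longrightarrow> Neg \<beta> |\<notin>| H \<Longrightarrow> (\<beta> \<in># \<Gamma> \<or> \<beta> = Neg \<alpha>) \<Longrightarrow> \<alpha> \<notin># \<Gamma>
       \<Longrightarrow> G3H L (finsert (Neg \<beta>) H) (\<Gamma> + {#Neg \<alpha>#}) \<alpha>
       \<Longrightarrow> G3H L {||} (\<Gamma> + {#Neg \<alpha>#} + {#\<alpha>#}) \<beta>
       \<Longrightarrow> G3H L H (\<Gamma> + {#Neg \<alpha>#}) (Neg \<beta>)"
| n4: "has_n L \<Longrightarrow> Neg \<beta> |\<notin>| H \<Longrightarrow> (\<beta> \<in># \<Gamma> \<or> \<beta> = Neg \<alpha>) \<Longrightarrow> \<alpha> \<in># \<Gamma>
       \<Longrightarrow> G3H L (finsert (Neg \<beta>) H) (\<Gamma> + {#Neg \<alpha>#}) \<alpha>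
       \<Longrightarrow> G3H L H (\<Gamma> + {#Neg \<alpha>#}) \<beta>
       \<Longrightarrow> G3H L H (\<Gamma> + {#Neg \<alpha>#}) (Neg \<beta>)"
| nef: "has_nef L \<Longrightarrow> Neg \<beta> |\<notin>| H
       \<Longrightarrow> G3H L (finsert (Neg \<beta>) H) (\<Gamma> + {#Neg \<alpha>#}) \<alpha>
       \<Longrightarrow> G3H L H (\<Gamma> + {#Neg \<alpha>#}) (Neg \<beta>)"
| copc1: "has_copc L \<Longrightarrow> \<beta> \<notin># \<Gamma> \<Longrightarrow> \<beta> \<noteq> Neg \<alpha>
       \<Longrightarrow> G3H L {||} (\<Gamma> + {#Neg \<alpha>#} + {#\<beta>#}) \<alpha>
       \<Longrightarrow> G3H L H (\<Gamma> + {#Neg \<alpha>#}) (Neg \<beta>)"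
| copc2: "has_copc L \<Longrightarrow> Neg \<beta> |\<notin>| H \<Longrightarrow> (\<beta> \<in># \<Gamma> \<or> \<beta> = Neg \<alpha>)
       \<Longrightarrow> G3H L (finsert (Neg \<beta>) H) (\<Gamma> + {#Neg \<alpha>#}) \<alpha>
       \<Longrightarrow> G3H L H (\<Gamma> + {#Neg \<alpha>#}) (Neg \<beta>)"
| an: "has_an L \<Longrightarrow> \<alpha> \<notin># \<Gamma>
       \<Longrightarrow> G3H L {||} (\<Gamma> + {#\<alpha>#}) (Neg \<alpha>)
       \<Longrightarrow> G3H L H \<Gamma> (Neg \<alpha>)"

end

theory Submission
  imports Defs
begin

text \<open>
  Both calculi are compared with a cumulative calculus \<open>G3S\<close> on sets of formulas, indexed by a bound on
  the height, whose left rules keep their principal formula and apply only to the goals allowed in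
  the history calculus.  From \<open>G3S\<close> to \<open>G3\<close>, one shows \<open>\<Gamma> \<Rightarrow> \<phi>\<close> whenever every formula of the
  antecedent is \<^emph>\<open>covered\<close> by \<open>\<Gamma>\<close>, that is, obtained from \<open>\<Gamma>\<close> by undoing left rules; this
  accounts for weakening, contraction and inversion at once.  From \<open>G3S\<close> to the history calculus,
  one takes derivations of minimal height: every side condition that fails would yield a shorter
  derivation of the same sequent.  The invariant is that no formula of the history is derivable
  from the current antecedent within the current height.
\<close>

section \<open>Cumulative calculus on sets, with height bounds\<close>

inductive G3S :: "logic \<Rightarrow> nat \<Rightarrow> form set \<Rightarrow> form \<Rightarrow> bool" for L where
  ax: "Var p \<in> S \<Longrightarrow> G3S L k S (Var p)"
| top: "G3S L k S Top"
| impR: "G3S L k (insert \<alpha> S) \<beta> \<Longrightarrow> G3S L (Suc k) S (Imp \<alpha> \<beta>)"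
| impL: "left_goal \<phi> \<Longrightarrow> Imp \<alpha> \<beta> \<in> S \<Longrightarrow> G3S L k S \<alpha> \<Longrightarrow> G3S L k (insert \<beta> S) \<phi>
         \<Longrightarrow> G3S L (Suc k) S \<phi>"
| andR: "G3S L k S \<alpha> \<Longrightarrow> G3S L k S \<beta> \<Longrightarrow> G3S L (Suc k) S (And \<alpha> \<beta>)"
| andL1: "left_goal \<phi> \<Longrightarrow> And \<alpha> \<beta> \<in> S \<Longrightarrow> G3S L k (insert \<alpha> S) \<phi> \<Longrightarrow> G3S L (Suc k) S \<phi>"
| andL2: "left_goal \<phi> \<Longrightarrow> And \<alpha> \<beta> \<in> S \<Longrightarrow> G3S L k (insert \<beta> S) \<phi> \<Longrightarrow> G3S L (Suc k) S \<phi>"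
| orR1: "G3S L k S \<alpha> \<Longrightarrow> G3S L (Suc k) S (Or \<alpha> \<beta>)"
| orR2: "G3S L k S \<beta> \<Longrightarrow> G3S L (Suc k) S (Or \<alpha> \<beta>)"
| orL: "left_goal \<phi> \<Longrightarrow> Or \<alpha> \<beta> \<in> S \<Longrightarrow> G3S L k (insert \<alpha> S) \<phi> \<Longrightarrow> G3S L k (insert \<beta> S) \<phi>
        \<Longrightarrow> G3S L (Suc k) S \<phi>"
| n: "has_n L \<Longrightarrow> Neg \<alpha> \<in> S \<Longrightarrow> G3S L k (insert \<beta> S) \<alpha> \<Longrightarrow> G3S L k (insert \<alpha> S) \<beta>
      \<Longrightarrow> G3S L (Suc k) S (Neg \<beta>)"
| nef: "has_nef L \<Longrightarrow> Neg \<alpha> \<in> S \<Longrightarrow> G3S L k S \<alpha> \<Longrightarrow> G3S L (Suc k) S (Neg \<beta>)"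
| copc: "has_copc L \<Longrightarrow> Neg \<alpha> \<in> S \<Longrightarrow> G3S L k (insert \<beta> S) \<alpha> \<Longrightarrow> G3S L (Suc k) S (Neg \<beta>)"
| an: "has_an L \<Longrightarrow> G3S L k (insert \<alpha> S) (Neg \<alpha>) \<Longrightarrow> G3S L (Suc k) S (Neg \<alpha>)"

text \<open>No rule of \<open>G3S\<close> asks for a formula to be absent from the antecedent, and
  the axioms hold at every bound; so a larger antecedent and a larger bound carry through each
  rule.\<close>

lemma G3S_mono:
  assumes "G3S L k S \<phi>" "k \<le> m" "S \<subseteq> T"
  shows "G3S L m T \<phi>"
  using assms
proof (induction arbitrary: m T rule: G3S.induct)
  case (impR k \<alpha> S \<beta>)
  then obtain m' where "m = Suc m'" "k \<le> m'" by (cases m) auto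
  with impR show ?case by (metis G3S.impR insert_mono)
next
  case (impL \<phi> \<alpha> \<beta> S k)
  then obtain m' where "m = Suc m'" "k \<le> m'" by (cases m) auto
  with impL show ?case by (metis G3S.impL insert_mono subsetD)
next
  case (andR k S \<alpha> \<beta>)
  then obtain m' where "m = Suc m'" "k \<le> m'" by (cases m) auto
  with andR show ?case by (metis G3S.andR)
next
  case (andL1 \<phi> \<alpha> \<beta> S k)
  then obtain m' where "m = Suc m'" "k \<le> m'" by (cases m) auto
  with andL1 show ?case by (metis G3S.andL1 insert_mono subsetD)
next
  case (andL2 \<phi> \<alpha> \<beta> S k)
  then obtain m' where "m = Suc m'" "k \<le> m'" by (cases m) auto
  with andL2 show ?case by (metis G3S.andL2 insert_mono subsetD)
next
  case (orR1 k S \<alpha> \<beta>)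
  then obtain m' where "m = Suc m'" "k \<le> m'" by (cases m) auto
  with orR1 show ?case by (metis G3S.orR1)
next
  case (orR2 k S \<beta> \<alpha>)
  then obtain m' where "m = Suc m'" "k \<le> m'" by (cases m) auto
  with orR2 show ?case by (metis G3S.orR2)
next
  case (orL \<phi> \<alpha> \<beta> S k)
  then obtain m' where "m = Suc m'" "k \<le> m'" by (cases m) auto
  with orL show ?case by (metis G3S.orL insert_mono subsetD)
next
  case (n \<alpha> S k \<beta>)
  then obtain m' where "m = Suc m'" "k \<le> m'" by (cases m) auto
  with n show ?case by (metis G3S.n insert_mono subsetD)
next
  case (nef \<alpha> S k \<beta>)
  then obtain m' where "m = Suc m'" "k \<le> m'" by (cases m) auto
  with nef show ?case by (metis G3S.nef subsetD)
next
  case (copc \<alpha> S k \<beta>)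
  then obtain m' where "m = Suc m'" "k \<le> m'" by (cases m) auto
  with copc show ?case by (metis G3S.copc insert_mono subsetD)
next
  case (an k \<alpha> S)
  then obtain m' where "m = Suc m'" "k \<le> m'" by (cases m) auto
  with an show ?case by (metis G3S.an insert_mono)
qed (auto intro: G3S.ax G3S.top)

section \<open>Derivability without heights and its admissible rules\<close>

definition S_derivable :: "logic \<Rightarrow> form set \<Rightarrow> form \<Rightarrow> bool" where
  "S_derivable L S \<phi> \<longleftrightarrow> (\<exists>k. G3S L k S \<phi>)"

lemma S_derivable_weaken: "S_derivable L S \<phi> \<Longrightarrow> S \<subseteq> T \<Longrightarrow> S_derivable L T \<phi>"
  unfolding S_derivable_def using G3S_mono by blast

text \<open>Two-premise rules of \<open>G3S\<close> want one bound for both premises; the maximum of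
  the two heights serves.\<close>

lemma S_derivable_common_height:
  assumes "S_derivable L S \<phi>" "S_derivable L T \<psi>"
  obtains k where "G3S L k S \<phi>" "G3S L k T \<psi>"
  using assms unfolding S_derivable_def
  by (metis G3S_mono max.cobounded1 max.cobounded2 subset_refl)

lemma S_derivable_impR: "S_derivable L (insert \<alpha> S) \<beta> \<Longrightarrow> S_derivable L S (Imp \<alpha> \<beta>)"
  unfolding S_derivable_def using G3S.impR by blast

lemma S_derivable_andR: "S_derivable L S \<alpha> \<Longrightarrow> S_derivable L S \<beta> \<Longrightarrow> S_derivable L S (And \<alpha> \<beta>)"
  by (metis S_derivable_common_height S_derivable_def G3S.andR)

inductive_cases G3S_ImpE: "G3S L k S (Imp \<alpha> \<beta>)"
inductive_cases G3S_AndE: "G3S L k S (And \<alpha> \<beta>)"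

text \<open>As \<open>left_goal\<close> fails for implications, only \<open>impR\<close> can end the
  derivation, and its premise is the claim.\<close>

lemma S_derivable_impR_inv: "S_derivable L S (Imp \<alpha> \<beta>) \<Longrightarrow> S_derivable L (insert \<alpha> S) \<beta>"
  unfolding S_derivable_def by (auto elim: G3S_ImpE)

lemma S_derivable_andR_inv:
  "S_derivable L S (And \<alpha> \<beta>) \<Longrightarrow> S_derivable L S \<alpha> \<and> S_derivable L S \<beta>"
  unfolding S_derivable_def by (auto elim: G3S_AndE)

text \<open>
  The restriction to \<open>left_goal\<close> costs nothing: implications and conjunctions on the right can
  only come from their right rules, so a left rule can be pushed above these.  The sets in \<open>B\<close>
  are the formulas added by the premises of the left rule.
\<close>

lemma S_derivable_left_rule:
  assumes "\<And>T \<psi>. S \<subseteq> T \<Longrightarrow> left_goal \<psi> \<Longrightarrow> \<forall>X\<in>B. S_derivable L (X \<union> T) \<psi> \<Longrightarrow> S_derivable L T \<psi>"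
    and "\<forall>X\<in>B. S_derivable L (X \<union> S) \<phi>"
  shows "S_derivable L S \<phi>"
  using assms
proof (induction \<phi> arbitrary: S)
  case Top
  show ?case unfolding S_derivable_def using G3S.top by blast
next
  case (And \<phi>1 \<phi>2)
  have "S_derivable L S \<phi>1"
    by (rule And.IH(1)) (use And.prems in \<open>auto dest: S_derivable_andR_inv\<close>)
  moreover have "S_derivable L S \<phi>2"
    by (rule And.IH(2)) (use And.prems in \<open>auto dest: S_derivable_andR_inv\<close>)
  ultimately show ?case by (rule S_derivable_andR)
next
  case (Imp \<phi>1 \<phi>2)
  \<comment> \<open>The antecedent grows by \<open>\<phi>1\<close> here; this is why the first
    hypothesis speaks of every superset \<open>T\<close> of \<open>S\<close>.\<close>
  have "\<forall>X\<in>B. S_derivable L (X \<union> insert \<phi>1 S) \<phi>2"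
    using Imp.prems(2) S_derivable_impR_inv by fastforce
  then have "S_derivable L (insert \<phi>1 S) \<phi>2"
    by (intro Imp.IH(2)) (use Imp.prems(1) in auto)
  then show ?case by (rule S_derivable_impR)
qed auto

lemma S_derivable_impL:
  assumes "Imp \<alpha> \<beta> \<in> S" "S_derivable L S \<alpha>" "S_derivable L (insert \<beta> S) \<phi>"
  shows "S_derivable L S \<phi>"
proof (rule S_derivable_left_rule[where B = "{{\<beta>}}"])
  fix T \<psi>
  assume "S \<subseteq> T" "left_goal \<psi>" "\<forall>X\<in>{{\<beta>}}. S_derivable L (X \<union> T) \<psi>"
  moreover from this assms have "S_derivable L T \<alpha>" by (auto intro: S_derivable_weaken)
  ultimately obtain k where "G3S L k T \<alpha>" "G3S L k (insert \<beta> T) \<psi>"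
    by (auto elim: S_derivable_common_height)
  then show "S_derivable L T \<psi>"
    unfolding S_derivable_def using G3S.impL \<open>S \<subseteq> T\<close> \<open>left_goal \<psi>\<close> assms(1) by blast
qed (use assms in auto)

lemma S_derivable_andL1:
  assumes "And \<alpha> \<beta> \<in> S" "S_derivable L (insert \<alpha> S) \<phi>"
  shows "S_derivable L S \<phi>"
  by (rule S_derivable_left_rule[where B = "{{\<alpha>}}"])
    (use assms G3S.andL1 in \<open>auto simp: S_derivable_def, blast\<close>)

lemma S_derivable_andL2:
  assumes "And \<alpha> \<beta> \<in> S" "S_derivable L (insert \<beta> S) \<phi>"
  shows "S_derivable L S \<phi>"
  by (rule S_derivable_left_rule[where B = "{{\<beta>}}"])
    (use assms G3S.andL2 in \<open>auto simp: S_derivable_def, blast\<close>)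

lemma S_derivable_orL:
  assumes "Or \<alpha> \<beta> \<in> S" "S_derivable L (insert \<alpha> S) \<phi>" "S_derivable L (insert \<beta> S) \<phi>"
  shows "S_derivable L S \<phi>"
proof (rule S_derivable_left_rule[where B = "{{\<alpha>}, {\<beta>}}"])
  fix T \<psi>
  assume "S \<subseteq> T" "left_goal \<psi>" "\<forall>X\<in>{{\<alpha>}, {\<beta>}}. S_derivable L (X \<union> T) \<psi>"
  moreover from this obtain k where "G3S L k (insert \<alpha> T) \<psi>" "G3S L k (insert \<beta> T) \<psi>"
    by (auto elim: S_derivable_common_height)
  ultimately show "S_derivable L T \<psi>"
    unfolding S_derivable_def using G3S.orL assms(1) by blast
qed (use assms in auto)

lemma S_derivable_n:
  assumes "has_n L" "Neg \<alpha> \<in> S" "S_derivable L (insert \<beta> S) \<alpha>" "S_derivable L (insert \<alpha> S) \<beta>"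
  shows "S_derivable L S (Neg \<beta>)"
  using assms by (metis S_derivable_common_height S_derivable_def G3S.n)

lemma S_derivable_nef:
  "has_nef L \<Longrightarrow> Neg \<alpha> \<in> S \<Longrightarrow> S_derivable L S \<alpha> \<Longrightarrow> S_derivable L S (Neg \<beta>)"
  unfolding S_derivable_def using G3S.nef by blast

lemma S_derivable_copc:
  "has_copc L \<Longrightarrow> Neg \<alpha> \<in> S \<Longrightarrow> S_derivable L (insert \<beta> S) \<alpha> \<Longrightarrow> S_derivable L S (Neg \<beta>)"
  unfolding S_derivable_def using G3S.copc by blast

lemma S_derivable_an:
  "has_an L \<Longrightarrow> S_derivable L (insert \<alpha> S) (Neg \<alpha>) \<Longrightarrow> S_derivable L S (Neg \<alpha>)"
  unfolding S_derivable_def using G3S.an by blast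

lemma S_derivable_right:
  "Var p \<in> S \<Longrightarrow> S_derivable L S (Var p)"
  "S_derivable L S Top"
  "S_derivable L S \<alpha> \<Longrightarrow> S_derivable L S (Or \<alpha> \<beta>)"
  "S_derivable L S \<beta> \<Longrightarrow> S_derivable L S (Or \<alpha> \<beta>)"
  unfolding S_derivable_def by (auto intro: G3S.ax G3S.top dest: G3S.orR1 G3S.orR2)

section \<open>From both calculi to the set calculus\<close>

text \<open>Where \<open>G3\<close> drops a principal formula that \<open>G3S\<close> keeps,
  weakening restores it.\<close>

lemma G3_imp_S_derivable: "G3 L \<Gamma> \<phi> \<Longrightarrow> S_derivable L (set_mset \<Gamma>) \<phi>"
proof (induction rule: G3.induct)
  case (impR \<Gamma> \<alpha> \<beta>)
  then show ?case by (simp add: S_derivable_impR)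
next
  case (impL \<Gamma> \<alpha> \<beta> \<phi>)
  show ?case
    by (rule S_derivable_impL[of \<alpha> \<beta>]) (use impL.IH in \<open>auto intro: S_derivable_weaken\<close>)
next
  case (andR \<Gamma> \<alpha> \<beta>)
  then show ?case by (simp add: S_derivable_andR)
next
  case (andL \<Gamma> \<alpha> \<beta> \<phi>)
  \<comment> \<open>\<open>G3\<close> adds both conjuncts at once, the set calculus one at a time:
    reading upwards, first \<open>\<alpha>\<close>, then \<open>\<beta>\<close>.\<close>
  show ?case
    by (rule S_derivable_andL1[of \<alpha> \<beta>], simp, rule S_derivable_andL2[of \<alpha> \<beta>])
      (use andL.IH in \<open>auto intro: S_derivable_weaken\<close>)
next
  case (orL \<Gamma> \<alpha> \<phi> \<beta>)
  show ?case
    by (rule S_derivable_orL[of \<alpha> \<beta>]) (use orL.IH in \<open>auto intro: S_derivable_weaken\<close>)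
next
  case (n \<Gamma> \<alpha> \<beta>)
  then show ?case by (intro S_derivable_n[of L \<alpha>]) auto
next
  case (nef \<Gamma> \<alpha> \<beta>)
  then show ?case by (intro S_derivable_nef[of L \<alpha>]) auto
next
  case (copc \<Gamma> \<alpha> \<beta>)
  then show ?case by (intro S_derivable_copc[of L \<alpha>]) auto
next
  case (an \<Gamma> \<alpha>)
  show ?case by (rule S_derivable_an) (use an in auto)
qed (simp_all add: S_derivable_right)

text \<open>Histories and side conditions only restrict rule instances and can be forgotten. A
  premise that leaves out a formula because it is already present becomes the set premise by
  absorption or weakening.\<close>

lemma G3H_imp_S_derivable: "G3H L H \<Gamma> \<phi> \<Longrightarrow> S_derivable L (set_mset \<Gamma>) \<phi>"
proof (induction rule: G3H.induct)
  case (impR1 \<alpha> \<Gamma> \<beta> H)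
  then show ?case by (simp add: S_derivable_impR)
next
  case (impR2 \<alpha> \<Gamma> H \<beta>)
  then show ?case by (simp add: S_derivable_impR insert_absorb)
next
  case (impL \<phi> H \<beta> \<Gamma> \<alpha>)
  show ?case by (rule S_derivable_impL[of \<alpha> \<beta>]) (use impL.IH in auto)
next
  case (andR H \<Gamma> \<alpha> \<beta>)
  then show ?case by (simp add: S_derivable_andR)
next
  case (andL1 \<phi> \<alpha> \<Gamma> \<beta> H)
  show ?case by (rule S_derivable_andL1[of \<alpha> \<beta>]) (use andL1.IH in auto)
next
  case (andL2 \<phi> \<beta> \<Gamma> \<alpha> H)
  show ?case by (rule S_derivable_andL2[of \<alpha> \<beta>]) (use andL2.IH in auto)
next
  case (orL \<phi> \<alpha> \<Gamma> \<beta> H)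
  show ?case by (rule S_derivable_orL[of \<alpha> \<beta>]) (use orL.IH in auto)
next
  case (n1 \<beta> \<Gamma> \<alpha> H)
  then show ?case by (intro S_derivable_n[of L \<alpha>]) auto
next
  case (n2 \<beta> \<Gamma> \<alpha> H)
  then show ?case by (intro S_derivable_n[of L \<alpha>]) (auto intro: S_derivable_weaken)
next
  case (n3 \<beta> H \<Gamma> \<alpha>)
  then show ?case by (intro S_derivable_n[of L \<alpha>]) (auto intro: S_derivable_weaken)
next
  case (n4 \<beta> H \<Gamma> \<alpha>)
  then show ?case by (intro S_derivable_n[of L \<alpha>]) (auto intro: S_derivable_weaken)
next
  case (nef \<beta> H \<Gamma> \<alpha>)
  then show ?case by (intro S_derivable_nef[of L \<alpha>]) auto
next
  case (copc1 \<beta> \<Gamma> \<alpha> H)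
  then show ?case by (intro S_derivable_copc[of L \<alpha>]) auto
next
  case (copc2 \<beta> H \<Gamma> \<alpha>)
  then show ?case by (intro S_derivable_copc[of L \<alpha>]) (auto intro: S_derivable_weaken)
next
  case (an \<alpha> \<Gamma> H)
  show ?case by (rule S_derivable_an) (use an in auto)
qed (simp_all add: S_derivable_right)

section \<open>From the set calculus to the ordinary calculus\<close>

inductive_set covered :: "form multiset \<Rightarrow> form set" for \<Gamma> where
  mem: "\<phi> \<in># \<Gamma> \<Longrightarrow> \<phi> \<in> covered \<Gamma>"
| conj: "\<alpha> \<in> covered \<Gamma> \<Longrightarrow> \<beta> \<in> covered \<Gamma> \<Longrightarrow> And \<alpha> \<beta> \<in> covered \<Gamma>"
| disj1: "\<alpha> \<in> covered \<Gamma> \<Longrightarrow> Or \<alpha> \<beta> \<in> covered \<Gamma>"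
| disj2: "\<beta> \<in> covered \<Gamma> \<Longrightarrow> Or \<alpha> \<beta> \<in> covered \<Gamma>"
| imp: "\<beta> \<in> covered \<Gamma> \<Longrightarrow> Imp \<alpha> \<beta> \<in> covered \<Gamma>"

text \<open>All clauses but \<open>mem\<close> are closure conditions that
  \<open>covered \<Delta>\<close> satisfies too. The typical use takes \<open>\<Delta>\<close> to be
  \<open>\<Gamma>\<close> after a left rule has replaced its principal formula.\<close>

lemma covered_trans:
  assumes "\<And>\<psi>. \<psi> \<in># \<Gamma> \<Longrightarrow> \<psi> \<in> covered \<Delta>"
  shows "covered \<Gamma> \<subseteq> covered \<Delta>"
proof
  fix \<phi> assume "\<phi> \<in> covered \<Gamma>"
  then show "\<phi> \<in> covered \<Delta>"
    by induction (auto intro: assms covered.intros)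
qed

lemma insert_subset_covered: "S \<subseteq> covered \<Gamma> \<Longrightarrow> insert \<alpha> S \<subseteq> covered (\<Gamma> + {#\<alpha>#})"
  using covered_trans[of \<Gamma> "\<Gamma> + {#\<alpha>#}"] by (fastforce intro: covered.mem)

text \<open>Only the clause \<open>mem\<close> yields a variable, and likewise a negation below.
  Hence axioms and negation rules find their formula in \<open>\<Gamma>\<close> itself.\<close>

lemma Var_covered: "Var p \<in> covered \<Gamma> \<Longrightarrow> Var p \<in># \<Gamma>"
  by (auto elim: covered.cases)

lemma Neg_covered: "Neg \<alpha> \<in> covered \<Gamma> \<Longrightarrow> Neg \<alpha> \<in># \<Gamma>"
  by (auto elim: covered.cases)

text \<open>A left rule of \<open>G3S\<close> is simulated only if its principal formula is a member
  of \<open>\<Gamma>\<close>; the parts that replace it still cover it. If it is covered in another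
  way, so is the formula added in some premise, whose induction hypothesis applies to
  \<open>\<Gamma>\<close> unchanged.\<close>

lemma G3S_imp_G3:
  assumes "G3S L k S \<phi>" "S \<subseteq> covered \<Gamma>"
  shows "G3 L \<Gamma> \<phi>"
  using assms
proof (induction arbitrary: \<Gamma> rule: G3S.induct)
  case (ax p S k)
  then have "Var p \<in># \<Gamma>" using Var_covered by blast
  then show ?case using G3.ax[of L "\<Gamma> - {#Var p#}" p] by simp
next
  case (top k S)
  show ?case by (rule G3.top)
next
  case (impR k \<alpha> S \<beta>)
  then show ?case by (metis G3.impR insert_subset_covered)
next
  case (impL \<phi> \<alpha> \<beta> S k)
  then have "Imp \<alpha> \<beta> \<in> covered \<Gamma>" by blast
  then show ?case
  proof cases
    case mem
    then obtain \<Delta> where \<Delta>: "\<Gamma> = \<Delta> + {#Imp \<alpha> \<beta>#}" by (metis add_mset_add_single mset_add)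
    \<comment> \<open>\<open>G3\<close> drops the implication in its second premise, but
      \<open>\<beta>\<close> alone covers it. The first premise keeps it and is handled with
      \<open>\<Gamma>\<close> itself.\<close>
    have "covered \<Gamma> \<subseteq> covered (\<Delta> + {#\<beta>#})"
      by (rule covered_trans) (auto 0 5 simp: \<Delta> intro: covered.intros)
    moreover have "\<beta> \<in> covered (\<Delta> + {#\<beta>#})" by (simp add: covered.mem)
    ultimately have "G3 L (\<Delta> + {#\<beta>#}) \<phi>" using impL by blast
    with impL show ?thesis unfolding \<Delta> by (blast intro: G3.impL)
  qed (use impL in auto)
next
  case (andR k S \<alpha> \<beta>)
  then show ?case by (blast intro: G3.andR)
next
  case (andL1 \<phi> \<alpha> \<beta> S k)
  then have "And \<alpha> \<beta> \<in> covered \<Gamma>" by blast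
  then show ?case
  proof cases
    case mem
    then obtain \<Delta> where \<Delta>: "\<Gamma> = \<Delta> + {#And \<alpha> \<beta>#}" by (metis add_mset_add_single mset_add)
    have "covered \<Gamma> \<subseteq> covered (\<Delta> + {#\<alpha>#} + {#\<beta>#})"
      by (rule covered_trans) (auto 0 5 simp: \<Delta> intro: covered.intros)
    moreover have "\<alpha> \<in> covered (\<Delta> + {#\<alpha>#} + {#\<beta>#})" by (simp add: covered.mem)
    ultimately have "G3 L (\<Delta> + {#\<alpha>#} + {#\<beta>#}) \<phi>" using andL1 by blast
    then show ?thesis unfolding \<Delta> by (rule G3.andL)
  qed (use andL1 in auto)
next
  case (andL2 \<phi> \<alpha> \<beta> S k)
  then have "And \<alpha> \<beta> \<in> covered \<Gamma>" by blast
  then show ?case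
  proof cases
    case mem
    then obtain \<Delta> where \<Delta>: "\<Gamma> = \<Delta> + {#And \<alpha> \<beta>#}" by (metis add_mset_add_single mset_add)
    have "covered \<Gamma> \<subseteq> covered (\<Delta> + {#\<alpha>#} + {#\<beta>#})"
      by (rule covered_trans) (auto 0 5 simp: \<Delta> intro: covered.intros)
    moreover have "\<beta> \<in> covered (\<Delta> + {#\<alpha>#} + {#\<beta>#})" by (simp add: covered.mem)
    ultimately have "G3 L (\<Delta> + {#\<alpha>#} + {#\<beta>#}) \<phi>" using andL2 by blast
    then show ?thesis unfolding \<Delta> by (rule G3.andL)
  qed (use andL2 in auto)
next
  case (orR1 k S \<alpha> \<beta>)
  then show ?case by (blast intro: G3.orR1)
next
  case (orR2 k S \<beta> \<alpha>)
  then show ?case by (blast intro: G3.orR2)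
next
  case (orL \<phi> \<alpha> \<beta> S k)
  then have "Or \<alpha> \<beta> \<in> covered \<Gamma>" by blast
  then show ?case
  proof cases
    case mem
    then obtain \<Delta> where \<Delta>: "\<Gamma> = \<Delta> + {#Or \<alpha> \<beta>#}" by (metis add_mset_add_single mset_add)
    have "covered \<Gamma> \<subseteq> covered (\<Delta> + {#\<alpha>#})" "covered \<Gamma> \<subseteq> covered (\<Delta> + {#\<beta>#})"
      by (rule covered_trans; auto 0 5 simp: \<Delta> intro: covered.intros)+
    moreover have "\<alpha> \<in> covered (\<Delta> + {#\<alpha>#})" "\<beta> \<in> covered (\<Delta> + {#\<beta>#})"
      by (simp_all add: covered.mem)
    ultimately have "insert \<alpha> S \<subseteq> covered (\<Delta> + {#\<alpha>#})" "insert \<beta> S \<subseteq> covered (\<Delta> + {#\<beta>#})"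
      using orL.prems by auto
    then have "G3 L (\<Delta> + {#\<alpha>#}) \<phi>" "G3 L (\<Delta> + {#\<beta>#}) \<phi>" by (simp_all only: orL.IH)
    then show ?thesis unfolding \<Delta> by (rule G3.orL)
  qed (use orL in auto)
next
  case (n \<alpha> S k \<beta>)
  then obtain \<Delta> where \<Delta>: "\<Gamma> = \<Delta> + {#Neg \<alpha>#}"
    by (metis Neg_covered add_mset_add_single mset_add subsetD)
  show ?case unfolding \<Delta>
    by (rule G3.n) (use n insert_subset_covered \<Delta> in blast)+
next
  case (nef \<alpha> S k \<beta>)
  then obtain \<Delta> where \<Delta>: "\<Gamma> = \<Delta> + {#Neg \<alpha>#}"
    by (metis Neg_covered add_mset_add_single mset_add subsetD)
  with nef show ?case by (blast intro: G3.nef)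
next
  case (copc \<alpha> S k \<beta>)
  then obtain \<Delta> where \<Delta>: "\<Gamma> = \<Delta> + {#Neg \<alpha>#}"
    by (metis Neg_covered add_mset_add_single mset_add subsetD)
  show ?case unfolding \<Delta>
    by (rule G3.copc) (use copc insert_subset_covered \<Delta> in blast)+
next
  case (an k \<alpha> S)
  then show ?case by (metis G3.an insert_subset_covered)
qed

section \<open>From the set calculus to the history calculus\<close>

text \<open>Induction on the bound rather than on the derivation: a sequent that is already
  derivable within a smaller bound is given to the induction hypothesis, and its longer derivation
  is discarded.\<close>

lemma G3S_imp_G3H:
  assumes "G3S L k (set_mset \<Gamma>) \<phi>" "\<And>\<psi>. \<psi> |\<in>| H \<Longrightarrow> \<not> G3S L k (set_mset \<Gamma>) \<psi>"
  shows "G3H L H \<Gamma> \<phi>"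
  using assms
proof (induction k arbitrary: \<Gamma> \<phi> H)
  case 0
  from 0(1) show ?case
  proof cases
    case (ax p)
    then show ?thesis using G3H.ax[of L H "\<Gamma> - {#Var p#}" p] by simp
  qed (simp add: G3H.top)
next
  case (Suc k)
  have hist: "\<not> G3S L k (set_mset \<Gamma>) \<psi>" if "\<psi> |\<in>| H" for \<psi>
    using Suc.prems(2)[OF that] G3S_mono[of L k _ \<psi> "Suc k"] by auto
  have same: "G3H L H \<Gamma> \<psi>" if "G3S L k (set_mset \<Gamma>) \<psi>" for \<psi>
    using Suc.IH that hist by blast
  show ?case
  \<comment> \<open>Minimality of the height enters here: in the second case \<open>\<phi>\<close>
    is derivable within \<open>Suc k\<close> but not within \<open>k\<close>.\<close>
  proof (cases "G3S L k (set_mset \<Gamma>) \<phi>")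
    case True
    then show ?thesis by (rule same)
  next
    case False
    have fresh: "\<phi> |\<notin>| H" using Suc.prems by blast
    \<comment> \<open>The case assumption \<open>False\<close> is exactly the invariant for the new
      history entry \<open>\<phi>\<close>.\<close>
    have push: "G3H L (finsert \<phi> H) \<Gamma> \<psi>" if "G3S L k (set_mset \<Gamma>) \<psi>" for \<psi>
      using that False hist by (intro Suc.IH) auto
    \<comment> \<open>Underivability need not survive a larger antecedent; the history is emptied,
      so the invariant is vacuous.\<close>
    have add: "G3H L {||} (\<Gamma> + {#\<alpha>#}) \<psi>" if "G3S L k (insert \<alpha> (set_mset \<Gamma>)) \<psi>" for \<alpha> \<psi>
      using that by (intro Suc.IH) auto
    have split: "\<exists>\<Delta>. \<Gamma> = \<Delta> + {#\<psi>#}" if "\<psi> \<in># \<Gamma>" for \<psi>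
      using that by (metis add_mset_add_single mset_add)
    have absorb: "G3S L k (set_mset \<Gamma>) \<psi>"
      if "G3S L k (insert \<alpha> (set_mset \<Gamma>)) \<psi>" "\<alpha> \<in># \<Gamma>" for \<alpha> \<psi>
      using that by (simp add: insert_absorb)
    \<comment> \<open>Were \<open>\<alpha>\<close> present, the premise would derive
      \<open>\<phi>\<close> from \<open>\<Gamma>\<close> within \<open>k\<close>, against
      minimality. This gives the freshness conditions of the left rules and of
      \<open>an\<close>.\<close>
    have new: "\<alpha> \<notin># \<Gamma>" if "G3S L k (insert \<alpha> (set_mset \<Gamma>)) \<phi>" for \<alpha>
      using that False absorb by blast
    from Suc.prems(1) show ?thesis
    proof cases
      case (ax p)
      then show ?thesis using G3H.ax[of L H "\<Gamma> - {#Var p#}" p] by simp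
    next
      case top
      then show ?thesis by (simp add: G3H.top)
    next
      case (impR \<alpha> \<beta>)
      then show ?thesis using G3H.impR1 G3H.impR2 add same absorb by metis
    next
      case (impL \<alpha> \<beta>)
      obtain \<Delta> where \<Delta>: "\<Gamma> = \<Delta> + {#Imp \<alpha> \<beta>#}" using split impL by blast
      have "\<beta> \<notin># \<Gamma>" using impL new by blast
      then show ?thesis
        using G3H.impL[of \<phi> H \<beta> \<Delta> L \<alpha>] impL fresh push[of \<alpha>] add[of \<beta> \<phi>] \<Delta> by simp
    next
      case (andR \<alpha> \<beta>)
      then show ?thesis by (auto intro: G3H.andR same)
    next
      case (andL1 \<alpha> \<beta>)
      obtain \<Delta> where \<Delta>: "\<Gamma> = \<Delta> + {#And \<alpha> \<beta>#}" using split andL1 by blast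
      have "\<alpha> \<notin># \<Gamma>" using andL1 new by blast
      then show ?thesis
        using G3H.andL1[of \<phi> \<alpha> \<Delta> L \<beta> H] andL1 add[of \<alpha> \<phi>] \<Delta> by simp
    next
      case (andL2 \<alpha> \<beta>)
      obtain \<Delta> where \<Delta>: "\<Gamma> = \<Delta> + {#And \<alpha> \<beta>#}" using split andL2 by blast
      have "\<beta> \<notin># \<Gamma>" using andL2 new by blast
      then show ?thesis
        using G3H.andL2[of \<phi> \<beta> \<Delta> L \<alpha> H] andL2 add[of \<beta> \<phi>] \<Delta> by simp
    next
      case (orR1 \<alpha> \<beta>)
      then show ?thesis by (auto intro: G3H.orR1 same)
    next
      case (orR2 \<beta> \<alpha>)
      then show ?thesis by (auto intro: G3H.orR2 same)
    next
      case (orL \<alpha> \<beta>)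
      obtain \<Delta> where \<Delta>: "\<Gamma> = \<Delta> + {#Or \<alpha> \<beta>#}" using split orL by blast
      have "\<alpha> \<notin># \<Gamma>" "\<beta> \<notin># \<Gamma>" using orL new by blast+
      then show ?thesis
        using G3H.orL[of \<phi> \<alpha> \<Delta> \<beta> L H] orL add[of \<alpha> \<phi>] add[of \<beta> \<phi>] \<Delta> by simp
    next
      case (n \<alpha> \<beta>)
      obtain \<Delta> where \<Delta>: "\<Gamma> = \<Delta> + {#Neg \<alpha>#}" using split n by blast
      \<comment> \<open>The side conditions mention \<open>\<Delta>\<close>, not
        \<open>\<Gamma>\<close>. The formula \<open>\<alpha>\<close> cannot be the removed
        \<open>Neg \<alpha>\<close>, whereas \<open>\<beta>\<close> can.\<close>
      have mem: "\<alpha> \<in># \<Gamma> \<longleftrightarrow> \<alpha> \<in># \<Delta>" "\<beta> \<in># \<Gamma> \<longleftrightarrow> \<beta> \<in># \<Delta> \<or> \<beta> = Neg \<alpha>" using \<Delta> by auto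
      \<comment> \<open>The rules \<open>n1\<close> to \<open>n4\<close> answer to which of the two
        premises really enlarges \<open>\<Gamma>\<close>. A premise with an absorbed formula keeps
        the history: extended by \<open>\<phi>\<close> if its goal is \<open>\<alpha>\<close>,
        unchanged if its goal is \<open>\<beta>\<close>.\<close>
      consider "\<beta> \<notin># \<Gamma>" "\<alpha> \<notin># \<Gamma>" | "\<beta> \<notin># \<Gamma>" "\<alpha> \<in># \<Gamma>" | "\<beta> \<in># \<Gamma>" "\<alpha> \<notin># \<Gamma>" | "\<beta> \<in># \<Gamma>" "\<alpha> \<in># \<Gamma>"
        by blast
      then show ?thesis
      proof cases
        case 1
        then show ?thesis
          using G3H.n1[of L \<beta> \<Delta> \<alpha> H, folded \<Delta>] n add[of \<alpha> \<beta>] add[of \<beta> \<alpha>] mem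
          by blast
      next
        case 2
        then show ?thesis
          using G3H.n2[of L \<beta> \<Delta> \<alpha> H, folded \<Delta>] n add[of \<beta> \<alpha>] same absorb[of \<alpha> \<beta>] mem
          by blast
      next
        case 3
        then show ?thesis
          using G3H.n3[of L \<beta> H \<Delta> \<alpha>, folded \<Delta>] n fresh add[of \<alpha> \<beta>] push[of \<alpha>] absorb[of \<beta> \<alpha>] mem
          by blast
      next
        case 4
        then show ?thesis
          using G3H.n4[of L \<beta> H \<Delta> \<alpha>, folded \<Delta>] n fresh same[of \<beta>] push[of \<alpha>] absorb[of \<beta> \<alpha>] absorb[of \<alpha> \<beta>] mem
          by blast
      qed
    next
      case (nef \<alpha> \<beta>)
      obtain \<Delta> where \<Delta>: "\<Gamma> = \<Delta> + {#Neg \<alpha>#}" using split nef by blast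
      then show ?thesis using G3H.nef[of L \<beta> H \<Delta> \<alpha>, folded \<Delta>] nef fresh push[of \<alpha>] by blast
    next
      case (copc \<alpha> \<beta>)
      obtain \<Delta> where \<Delta>: "\<Gamma> = \<Delta> + {#Neg \<alpha>#}" using split copc by blast
      have mem: "\<beta> \<in># \<Gamma> \<longleftrightarrow> \<beta> \<in># \<Delta> \<or> \<beta> = Neg \<alpha>" using \<Delta> by auto
      show ?thesis
      proof (cases "\<beta> \<in># \<Gamma>")
        case True
        then show ?thesis
          using G3H.copc2[of L \<beta> H \<Delta> \<alpha>, folded \<Delta>] copc fresh push[of \<alpha>] absorb[of \<beta> \<alpha>] mem
          by blast
      next
        case False
        then show ?thesis
          using G3H.copc1[of L \<beta> \<Delta> \<alpha> H, folded \<Delta>] copc add[of \<beta> \<alpha>] mem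
          by blast
      qed
    next
      case (an \<alpha>)
      then show ?thesis using G3H.an[of L \<alpha> \<Gamma> H] an new add by blast
    qed
  qed
qed

section \<open>The equivalence\<close>

theorem theorem5p4:
  fixes L :: logic and \<Gamma> :: "form multiset" and \<phi> :: form
  shows "G3 L \<Gamma> \<phi> \<longleftrightarrow> G3H L {||} \<Gamma> \<phi>"
proof
  assume "G3 L \<Gamma> \<phi>"
  then obtain k where "G3S L k (set_mset \<Gamma>) \<phi>"
    using G3_imp_S_derivable unfolding S_derivable_def by blast
  then show "G3H L {||} \<Gamma> \<phi>" by (rule G3S_imp_G3H) simp
next
  assume "G3H L {||} \<Gamma> \<phi>"
  then obtain k where "G3S L k (set_mset \<Gamma>) \<phi>"
    using G3H_imp_S_derivable unfolding S_derivable_def by blast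
  then show "G3 L \<Gamma> \<phi>" by (rule G3S_imp_G3) (auto intro: covered.mem)
qed

end
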